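(* Let the set ${\cal F}_y=\{y\in\mathbb R^m: c-A^*y\in K^*\}$ be bounded. Then $\nu_g=\nu\ge\nu_\zeta$.
   Context: $\mathbb E$ is a finite-dimensional real vector space with dual space $\mathbb E^*$; $\langle s,x\rangle$ is the value of $s\in\mathbb E^*$ at $x\in\mathbb E$. $K\subset\mathbb E$ is a closed convex pointed cone with nonempty interior, $K^*=\{s\in\mathbb E^*:\langle s,x\rangle\ge0\ \forall x\in K\}$. A self-concordant function is a closed convex three times differentiable function $f$ with open domain such that $D^3f(x)[h]^3\le 2(D^2f(x)[h]^2)^{3/2}$. $F$ is a $\nu$-normal (regular) barrier for $K$: a self-concordant function with domain $\mathrm{int}\,K$, tending to $+\infty$ at the boundary, with $F(\tau x)=F(x)-\nu\ln\tau$ for $\tau>0$ ($\nu\ge1$). Its dual barrier is $F_*(s)=\max_{x\in\mathrm{int}\,K}[-\langle s,x\rangle-F(x)]$, $s\in\mathrm{int}\,K^*$. $A:\mathbb E\to\mathbb R^m$ is linear with adjoint $A^*:\mathbb R^m\to\mathbb E^*$, $b\in\mathbb R^m\setminus\{0\}$, $c\in\mathbb E^*$; $(A^*,c):\mathbb R^{m+1}\to\mathbb E^*$ is injective, and there exists $(\tilde x,\tilde y,\tilde s)\in\mathrm{int}\,K\times\mathbb R^m\times\mathrm{int}\,K^*$ with $A\tilde x=b$, $\tilde s+A^*\tilde y=c$. $\nu_g$ is the barrier parameter of the restriction $g$ of $F$ to the relative interior of the primal feasible set ${\cal F}_p=\{x\in K:Ax=b\}$: $\nu_g=\sup\{\lambda_g^2(x):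 x\in\mathrm{int}\,K,\ Ax=b\}$ with $\lambda_g(x)=\max\{\langle\nabla F(x),h\rangle: Ah=0,\ \langle\nabla^2F(x)h,h\rangle\le1\}$. $\nu_\zeta$ is the barrier parameter of $\zeta(y)=F_*(c-A^*y)$ on ${\cal F}_y$: $\nu_\zeta=\sup_{y\in\mathrm{int}\,{\cal F}_y}\langle\nabla\zeta(y),[\nabla^2\zeta(y)]^{-1}\nabla\zeta(y)\rangle$. *)

theory Defs
  imports "HOL-Analysis.Analysis"
begin

text \<open>
  The dual space of \<open>'a\<close> is the type \<open>'a \<Rightarrow>\<^sub>L real\<close>, and the value of \<open>s\<close> at \<open>x\<close> is
  \<open>blinfun_apply s x\<close>, written \<open>s x\<close>. The inner product of \<open>'a :: euclidean_space\<close> plays no role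
  below; the class only supplies finite dimension and the canonical topology.
\<close>

text \<open>
  Total versions of the first three derivatives; they are meaningful only at points where the
  corresponding function is differentiable.
  \<open>hess f x h k\<close> is \<open>D\<^sup>2 f(x)[h, k]\<close>, and \<open>hess f x\<close> itself is the Hessian as an operator into
  the dual space.
\<close>

definition grad :: "('a::euclidean_space \<Rightarrow> real) \<Rightarrow> 'a \<Rightarrow> ('a \<Rightarrow>\<^sub>L real)" where
  "grad f x = Blinfun (frechet_derivative f (at x))"

definition hess :: "('a::euclidean_space \<Rightarrow> real) \<Rightarrow> 'a \<Rightarrow> ('a \<Rightarrow>\<^sub>L 'a \<Rightarrow>\<^sub>L real)" where
  "hess f x = Blinfun (frechet_derivative (grad f) (at x))"

definition third :: "('a::euclidean_space \<Rightarrow> real) \<Rightarrow> 'a \<Rightarrow> ('a \<Rightarrow>\<^sub>L 'a \<Rightarrow>\<^sub>L 'a \<Rightarrow>\<^sub>L real)" where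
  "third f x = Blinfun (frechet_derivative (hess f) (at x))"

lemma grad_eqI: "(f has_derivative blinfun_apply s) (at x) \<Longrightarrow> grad f x = s"
  by (simp add: grad_def frechet_derivative_at[symmetric] blinfun_apply_inverse)

lemma hess_eqI: "(grad f has_derivative blinfun_apply H) (at x) \<Longrightarrow> hess f x = H"
  by (simp add: hess_def frechet_derivative_at[symmetric] blinfun_apply_inverse)

lemma third_eqI: "(hess f has_derivative blinfun_apply T) (at x) \<Longrightarrow> third f x = T"
  by (simp add: third_def frechet_derivative_at[symmetric] blinfun_apply_inverse)

text \<open>
  All derivatives are taken at points of the open domain \<open>U\<close>, so the values of \<open>f\<close> outside \<open>U\<close>
  are irrelevant. ``Closed'' means that the epigraph of \<open>f\<close> over \<open>U\<close> is closed.
\<close>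

definition self_concordant :: "('a::euclidean_space) set \<Rightarrow> ('a \<Rightarrow> real) \<Rightarrow> bool" where
  "self_concordant U f \<longleftrightarrow>
     open U \<and> convex_on U f \<and> closed (epigraph U f) \<and>
     (\<forall>x\<in>U. f differentiable (at x) \<and> grad f differentiable (at x) \<and> hess f differentiable (at x)) \<and>
     (\<forall>x\<in>U. \<forall>h. third f x h h h \<le> 2 * (hess f x h h) powr (3 / 2))"

definition closed_convex_pointed_cone :: "('a::euclidean_space) set \<Rightarrow> bool" where
  "closed_convex_pointed_cone K \<longleftrightarrow>
     closed K \<and> convex K \<and> cone K \<and> K \<inter> uminus ` K = {0}"

definition normal_barrier :: "('a::euclidean_space) set \<Rightarrow> real \<Rightarrow> ('a \<Rightarrow> real) \<Rightarrow> bool" where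
  "normal_barrier K \<nu> F \<longleftrightarrow>
     \<nu> \<ge> 1 \<and> self_concordant (interior K) F \<and>
     (\<forall>z\<in>frontier K. filterlim F at_top (at z within interior K)) \<and>
     (\<forall>x\<in>interior K. \<forall>\<tau>>0. F (\<tau> *\<^sub>R x) = F x - \<nu> * ln \<tau>)"

definition dual_cone :: "('a::euclidean_space) set \<Rightarrow> ('a \<Rightarrow>\<^sub>L real) set" where
  "dual_cone K = {s :: 'a \<Rightarrow>\<^sub>L real. \<forall>x\<in>K. 0 \<le> s x}"

text \<open>
  The maximum is rendered as a supremum of reals; it is of interest only for \<open>s\<close> in the interior
  of the dual cone.
\<close>

definition dual_barrier ::
  "('a::euclidean_space) set \<Rightarrow> ('a \<Rightarrow> real) \<Rightarrow> ('a \<Rightarrow>\<^sub>L real) \<Rightarrow> real" where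
  "dual_barrier K F s = (SUP x\<in>interior K. - s x - F x)"

definition dual_adjoint ::
  "('a::euclidean_space \<Rightarrow>\<^sub>L (real ^ 'm)) \<Rightarrow> real ^ 'm \<Rightarrow> ('a \<Rightarrow>\<^sub>L real)" where
  "dual_adjoint A y = blinfun_inner_right y o\<^sub>L A"

lemma dual_adjoint_apply: "dual_adjoint A y x = y \<bullet> A x"
  by (simp add: dual_adjoint_def)

definition feasible_y ::
  "('a::euclidean_space) set \<Rightarrow> ('a \<Rightarrow>\<^sub>L (real ^ 'm)) \<Rightarrow> ('a \<Rightarrow>\<^sub>L real) \<Rightarrow> (real ^ 'm) set" where
  "feasible_y K A c = {y. c - dual_adjoint A y \<in> dual_cone K}"

text \<open>
  The suprema below are taken in \<open>ereal\<close>, so that an unbounded supremum is \<open>\<infinity>\<close> and no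
  boundedness is presupposed.
\<close>

definition lambda_g ::
  "('a::euclidean_space \<Rightarrow> real) \<Rightarrow> ('a \<Rightarrow>\<^sub>L (real ^ 'm)) \<Rightarrow> 'a \<Rightarrow> ereal" where
  "lambda_g F A x = (SUP h\<in>{h. A h = 0 \<and> hess F x h h \<le> 1}. ereal (grad F x h))"

definition nu_g ::
  "('a::euclidean_space) set \<Rightarrow> ('a \<Rightarrow> real) \<Rightarrow> ('a \<Rightarrow>\<^sub>L (real ^ 'm)) \<Rightarrow> real ^ 'm \<Rightarrow> ereal" where
  "nu_g K F A b = (SUP x\<in>{x \<in> interior K. A x = b}. (lambda_g F A x)\<^sup>2)"

definition zeta ::
  "('a::euclidean_space) set \<Rightarrow> ('a \<Rightarrow> real) \<Rightarrow> ('a \<Rightarrow>\<^sub>L (real ^ 'm)) \<Rightarrow> ('a \<Rightarrow>\<^sub>L real) \<Rightarrow>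
   real ^ 'm \<Rightarrow> real" where
  "zeta K F A c y = dual_barrier K F (c - dual_adjoint A y)"

text \<open>
  The inverse Hessian maps the dual of \<open>real ^ 'm\<close> back to \<open>real ^ 'm\<close>.
\<close>

definition nu_zeta ::
  "('a::euclidean_space) set \<Rightarrow> ('a \<Rightarrow> real) \<Rightarrow> ('a \<Rightarrow>\<^sub>L (real ^ 'm)) \<Rightarrow> ('a \<Rightarrow>\<^sub>L real) \<Rightarrow> ereal"
  where
  "nu_zeta K F A c =
     (SUP y\<in>interior (feasible_y K A c).
        ereal (grad (zeta K F A c) y
          (inv (blinfun_apply (hess (zeta K F A c) y)) (grad (zeta K F A c) y))))"

end

theory Submission
  imports Defs
begin

text \<open>
  Everything rests on one inequality. Differentiating the logarithmic homogeneity of \<open>F\<close> gives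
  \<open>D\<^sup>2F(x)[x, h] = D\<^sup>2F(x)[h, x] = -DF(x)[h]\<close> and \<open>DF(x)[x] = -\<nu>\<close>, so the Cauchy--Schwarz
  inequality for the Hessian form yields \<open>(DF(x)[h])\<^sup>2 \<le> \<nu> D\<^sup>2F(x)[h, h]\<close>, with equality for
  \<open>h = x\<close> (lemma \<open>grad_square_le\<close>). Both upper bounds follow from it.

  The restriction to the primal feasible set has parameter at most \<open>\<nu>\<close>. The
  direction \<open>h = x\<close> attaining equality is not tangent to \<open>{x. A x = b}\<close>, but it becomes so at
  infinity: if no \<open>d \<in> int K\<close> satisfied \<open>A d = 0\<close>, a hyperplane separating \<open>0\<close> from
  \<open>A(int K)\<close> would be a recession direction of the dual feasible set (\<open>kernel_meets_interior\<close>).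
  Boundedness thus provides such a \<open>d\<close>. Moving along \<open>x + t d\<close> and rescaling to
  \<open>d + x/t\<close>, the squared ratio of slope to local length in the direction \<open>d\<close> tends to its value
  at the point \<open>d\<close>, which is \<open>\<nu>\<close> (\<open>nu_g_ge\<close>).

  For the dual function put \<open>s = c - A\<^sup>*y\<close> and let \<open>x \<in> int K\<close> be the maximiser defining
  \<open>F\<^sub>*(s)\<close>, that is, the solution of \<open>\<nabla>F(x) = -s\<close>. If \<open>u(\<eta>)\<close> denotes the solution of
  \<open>\<nabla>\<^sup>2F(x) u = A\<^sup>*\<eta>\<close>, then \<open>\<nabla>\<zeta>(y)\<close> is represented by \<open>A x\<close> and \<open>\<nabla>\<^sup>2\<zeta>(y)\<eta>\<close> by
  \<open>A u(\<eta>)\<close> (\<open>zeta_derivatives\<close>). For the Newton direction \<open>w\<close> the number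
  \<open>p = \<langle>\<nabla>\<zeta>(y), w\<rangle>\<close> equals \<open>-DF(x)[u(w)]\<close> as well as \<open>D\<^sup>2F(x)[u(w), u(w)]\<close>, whence
  \<open>p\<^sup>2 \<le> \<nu> p\<close> (\<open>newton_decrement_zeta_le\<close>).

  That \<open>x\<close> depends differentiably on \<open>y\<close> follows from the invertibility of \<open>\<nabla>\<^sup>2F(x)\<close>. This is
  where self-concordance and pointedness enter: a direction of zero curvature would span a line
  contained in \<open>K\<close> (\<open>hess_definite\<close>).
\<close>

section \<open>Convexity and derivatives along lines\<close>

lemma has_derivative_grad:
  "f differentiable (at x) \<Longrightarrow> (f has_derivative blinfun_apply (grad f x)) (at x)"
  using frechet_derivative_works[of f "at x"]
  by (simp add: grad_def bounded_linear_Blinfun_apply has_derivative_bounded_linear)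

lemma has_derivative_hess:
  "grad f differentiable (at x) \<Longrightarrow> (grad f has_derivative blinfun_apply (hess f x)) (at x)"
  using frechet_derivative_works[of "grad f" "at x"]
  by (simp add: hess_def bounded_linear_Blinfun_apply has_derivative_bounded_linear)

lemma has_derivative_third:
  "hess f differentiable (at x) \<Longrightarrow> (hess f has_derivative blinfun_apply (third f x)) (at x)"
  using frechet_derivative_works[of "hess f" "at x"]
  by (simp add: third_def bounded_linear_Blinfun_apply has_derivative_bounded_linear)

lemma has_derivative_along_line:
  fixes x h :: "'a::real_normed_vector"
  assumes "(f has_derivative f') (at (x + t *\<^sub>R h))"
  shows "((\<lambda>t. f (x + t *\<^sub>R h)) has_vector_derivative f' h) (at t)"
proof -
  have "((\<lambda>t. x + t *\<^sub>R h) has_derivative (\<lambda>r. r *\<^sub>R h)) (at t)"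
    by (auto intro!: derivative_eq_intros)
  from has_derivative_compose[OF this assms] show ?thesis
    unfolding has_vector_derivative_def
    using linear_scale[OF has_derivative_linear[OF assms]] by simp
qed

lemma convex_on_above_tangent:
  fixes f :: "'a::real_normed_vector \<Rightarrow> real"
  assumes cvx: "convex_on U f" and x: "x \<in> U" and y: "y \<in> U"
    and f': "(f has_derivative f') (at x)"
  shows "f x + f' (y - x) \<le> f y"
proof (rule ccontr)
  assume neg: "\<not> ?thesis"
  let ?\<psi> = "\<lambda>t. f (x + t *\<^sub>R (y - x)) - t * (f y - f x)"
  have "((\<lambda>t. f (x + t *\<^sub>R (y - x))) has_real_derivative f' (y - x)) (at 0)"
    using has_derivative_along_line[of f f' x 0 "y - x"] f'
    by (simp add: has_real_derivative_iff_has_vector_derivative)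
  then have "(?\<psi> has_real_derivative f' (y - x) - (f y - f x)) (at 0)"
    by (auto intro!: derivative_eq_intros)
  then obtain d where d: "d > 0" "\<And>h. 0 < h \<Longrightarrow> h < d \<Longrightarrow> ?\<psi> 0 < ?\<psi> (0 + h)"
    using DERIV_pos_inc_right[of ?\<psi> "f' (y - x) - (f y - f x)" 0] neg by auto
  define h where "h = min 1 (d / 2)"
  have h: "0 < h" "h < d" "h \<le> 1" using d(1) by (auto simp: h_def)
  have "f ((1 - h) *\<^sub>R x + h *\<^sub>R y) \<le> (1 - h) * f x + h * f y"
    using convex_onD[OF cvx, of h x y] h x y by simp
  moreover have "(1 - h) *\<^sub>R x + h *\<^sub>R y = x + h *\<^sub>R (y - x)"
    by (simp add: algebra_simps)
  ultimately show False using d(2)[OF h(1,2)] by (simp add: algebra_simps)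
qed

section \<open>Self-concordant functions\<close>

locale self_concordant_function =
  fixes U :: "'a::euclidean_space set" and F :: "'a \<Rightarrow> real"
  assumes self_concordant: "self_concordant U F"
begin

lemma open_domain: "open U"
  and convex_F: "convex_on U F"
  and closed_epigraph: "closed (epigraph U F)"
  and third_le: "x \<in> U \<Longrightarrow> third F x h h h \<le> 2 * (hess F x h h) powr (3 / 2)"
  using self_concordant by (auto simp: self_concordant_def)

lemma convex_domain: "convex U"
  using convex_F by (simp add: convex_on_def)

lemma F_deriv: "x \<in> U \<Longrightarrow> (F has_derivative blinfun_apply (grad F x)) (at x)"
  and grad_deriv: "x \<in> U \<Longrightarrow> (grad F has_derivative blinfun_apply (hess F x)) (at x)"
  and hess_deriv: "x \<in> U \<Longrightarrow> (hess F has_derivative blinfun_apply (third F x)) (at x)"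
  using self_concordant
  by (auto simp: self_concordant_def intro: has_derivative_grad has_derivative_hess
      has_derivative_third)

lemma F_deriv_line:
  "x + t *\<^sub>R h \<in> U \<Longrightarrow>
    ((\<lambda>t. F (x + t *\<^sub>R h)) has_real_derivative grad F (x + t *\<^sub>R h) h) (at t)"
  using has_derivative_along_line[OF F_deriv]
  by (simp add: has_real_derivative_iff_has_vector_derivative)

lemma grad_deriv_line:
  assumes "x + t *\<^sub>R h \<in> U"
  shows "((\<lambda>t. grad F (x + t *\<^sub>R h) k) has_real_derivative hess F (x + t *\<^sub>R h) h k) (at t)"
  using bounded_linear.has_vector_derivative[OF blinfun.bounded_linear_left
      has_derivative_along_line[OF grad_deriv[OF assms]]]
  by (simp add: has_real_derivative_iff_has_vector_derivative)

lemma hess_deriv_line: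
  assumes "x + t *\<^sub>R h \<in> U"
  shows "((\<lambda>t. hess F (x + t *\<^sub>R h) k l) has_real_derivative third F (x + t *\<^sub>R h) h k l) (at t)"
proof -
  have "bounded_linear (\<lambda>B. blinfun_apply (blinfun_apply B k) l)"
    by (intro bounded_linear_compose[OF blinfun.bounded_linear_left blinfun.bounded_linear_left])
  from bounded_linear.has_vector_derivative[OF this
      has_derivative_along_line[OF hess_deriv[OF assms]]]
  show ?thesis by (simp add: has_real_derivative_iff_has_vector_derivative)
qed

lemma continuous_on_F: "continuous_on U F"
  and continuous_on_grad: "continuous_on U (grad F)"
  and continuous_on_hess: "continuous_on U (hess F)"
  using F_deriv grad_deriv hess_deriv
  by (auto simp: continuous_on_eq_continuous_at[OF open_domain]
      intro: has_derivative_continuous)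

lemma above_tangent: "x \<in> U \<Longrightarrow> y \<in> U \<Longrightarrow> F x + grad F x (y - x) \<le> F y"
  by (rule convex_on_above_tangent[OF convex_F _ _ F_deriv])

lemma segment_in_domain:
  assumes "x \<in> U" "x + T *\<^sub>R h \<in> U" "0 \<le> t" "t \<le> T"
  shows "x + t *\<^sub>R h \<in> U"
proof (cases "T = 0")
  case False
  define u where "u = t / T"
  have u: "0 \<le> u" "u \<le> 1" "u * T = t"
    using assms False by (auto simp: u_def)
  have "(1 - u) *\<^sub>R x + u *\<^sub>R (x + T *\<^sub>R h) \<in> U"
    using convexD_alt[OF convex_domain assms(1,2) u(1,2)] .
  moreover have "(1 - u) *\<^sub>R x + u *\<^sub>R (x + T *\<^sub>R h) = x + (u * T) *\<^sub>R h"
    by (simp add: algebra_simps)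
  ultimately show ?thesis using u(3) by simp
qed (use assms in auto)

text \<open>
  Adding the tangent inequalities at \<open>x\<close> and at a nearby point of the line shows that the
  slope along the line is nondecreasing.
\<close>

lemma hess_nonneg:
  assumes x: "x \<in> U"
  shows "0 \<le> hess F x h h"
proof (rule ccontr)
  assume neg: "\<not> ?thesis"
  have "((\<lambda>t. grad F (x + t *\<^sub>R h) h) has_real_derivative hess F x h h) (at 0)"
    using grad_deriv_line[of x 0 h h] x by simp
  then obtain d where d: "d > 0" "\<And>t. 0 < t \<Longrightarrow> t < d \<Longrightarrow> grad F (x + t *\<^sub>R h) h < grad F x h"
    using DERIV_neg_dec_right[of "\<lambda>t. grad F (x + t *\<^sub>R h) h" "hess F x h h" 0] neg by auto
  have "isCont (\<lambda>t. x + t *\<^sub>R h) 0" by (intro continuous_intros)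
  then have "\<forall>\<^sub>F t in at 0. x + t *\<^sub>R h \<in> U"
    using topological_tendstoD[of "\<lambda>t. x + t *\<^sub>R h" x "at 0" U] open_domain x
    by (simp add: isCont_def)
  then obtain e where e: "e > 0" "\<And>t. t \<noteq> 0 \<Longrightarrow> \<bar>t\<bar> < e \<Longrightarrow> x + t *\<^sub>R h \<in> U"
    by (auto simp: eventually_at dist_real_def)
  define t where "t = min (d / 2) (e / 2)"
  have t: "0 < t" "t < d" "t < e" using d(1) e(1) by (auto simp: t_def)
  let ?y = "x + t *\<^sub>R h"
  have y: "?y \<in> U" using e(2)[of t] t by simp
  have "F x + grad F x (?y - x) \<le> F ?y" "F ?y + grad F ?y (x - ?y) \<le> F x"
    using above_tangent x y by blast+
  then have "t * grad F x h \<le> t * grad F ?y h"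
    by (simp add: blinfun.scaleR_right blinfun.minus_right)
  then show False using d(2)[OF t(1,2)] t(1) by simp
qed

text \<open>
  Along a direction \<open>h\<close> the curvature \<open>\<phi>(t) = D\<^sup>2 F(x + t h)[h, h]\<close> satisfies the differential
  inequality \<open>\<phi>' \<le> 2 \<phi>\<^sup>3\<^sup>/\<^sup>2\<close>. On a compact segment \<open>\<phi>\<close> is bounded, so the right-hand side is
  at most a multiple of \<open>\<phi>\<close>, and Gronwall's argument keeps \<open>\<phi>\<close> at \<open>0\<close> once it is \<open>0\<close>.
\<close>

lemma hess_zero_propagates:
  assumes x: "x \<in> U" and xT: "x + T *\<^sub>R h \<in> U" and t: "0 \<le> t" "t \<le> T"
    and zero: "hess F x h h = 0"
  shows "hess F (x + t *\<^sub>R h) h h = 0"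
proof -
  let ?\<phi> = "\<lambda>t. hess F (x + t *\<^sub>R h) h h"
  have inU: "x + s *\<^sub>R h \<in> U" if "0 \<le> s" "s \<le> T" for s
    using segment_in_domain[OF x xT that] .
  have "continuous_on {0..T} ?\<phi>"
    by (rule DERIV_continuous_on[OF has_field_derivative_at_within[OF hess_deriv_line[OF inU]]])
      auto
  then obtain M where M: "\<And>s. 0 \<le> s \<Longrightarrow> s \<le> T \<Longrightarrow> ?\<phi> s \<le> M"
    using continuous_attains_sup[of "{0..T}" ?\<phi>] t by fastforce
  \<comment> \<open>With this constant \<open>2 \<phi>\<^sup>3\<^sup>/\<^sup>2 \<le> L \<phi>\<close> on the segment, so \<open>\<phi>(s) e\<^sup>-\<^sup>L\<^sup>s\<close> decreases.\<close>
  define L where "L = 2 * M powr (1/2)"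
  have "?\<phi> t * exp (- L * t) \<le> ?\<phi> 0 * exp (- L * 0)"
  proof (rule DERIV_nonpos_imp_nonincreasing[OF t(1)])
    fix s assume s: "0 \<le> s" "s \<le> t"
    then have sU: "x + s *\<^sub>R h \<in> U" using inU t by auto
    let ?d = "third F (x + s *\<^sub>R h) h h h * exp (- L * s) + ?\<phi> s * (exp (- L * s) * (- L))"
    have "((\<lambda>s. ?\<phi> s * exp (- L * s)) has_real_derivative ?d) (at s)"
      using hess_deriv_line[OF sU] by (auto intro!: derivative_eq_intros)
    moreover have "third F (x + s *\<^sub>R h) h h h \<le> L * ?\<phi> s"
    proof -
      have nn: "0 \<le> ?\<phi> s" using hess_nonneg[OF sU] .
      have "?\<phi> s powr (3/2) = ?\<phi> s * ?\<phi> s powr (1/2)"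
        using nn powr_mult_base[of "?\<phi> s" "1/2"] by simp
      also have "\<dots> \<le> ?\<phi> s * M powr (1/2)"
        using nn M[of s] s t by (intro mult_left_mono powr_mono2) auto
      finally show ?thesis
        using third_le[OF sU, of h] by (simp add: L_def algebra_simps)
    qed
    then have "(third F (x + s *\<^sub>R h) h h h - L * ?\<phi> s) * exp (- L * s) \<le> 0"
      by (intro mult_nonpos_nonneg) auto
    then have "?d \<le> 0" by (simp add: algebra_simps)
    ultimately show "\<exists>y. ((\<lambda>s. ?\<phi> s * exp (- L * s)) has_real_derivative y) (at s) \<and> y \<le> 0"
      by blast
  qed
  then have "?\<phi> t * exp (- L * t) \<le> 0" using zero by simp
  then have "?\<phi> t \<le> 0" by (simp add: mult_le_0_iff)
  then show ?thesis using hess_nonneg[OF inU[OF t], of h] by simp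
qed

lemma affine_of_hess_zero:
  assumes x: "x \<in> U" and xT: "x + T *\<^sub>R h \<in> U" and T: "0 \<le> T"
    and zero: "hess F x h h = 0"
  shows "F (x + T *\<^sub>R h) = F x + T * grad F x h"
proof (cases "T = 0")
  case False
  then have T0: "0 < T" using T by simp
  have inU: "x + s *\<^sub>R h \<in> U" if "0 \<le> s" "s \<le> T" for s
    using segment_in_domain[OF x xT that] .
  have const: "grad F (x + t *\<^sub>R h) h = grad F x h" if t: "0 < t" "t \<le> T" for t
  proof -
    have "(\<lambda>s. grad F (x + s *\<^sub>R h) h) t = (\<lambda>s. grad F (x + s *\<^sub>R h) h) 0"
    proof (rule DERIV_isconst_end[OF t(1)])
      show "continuous_on {0..t} (\<lambda>s. grad F (x + s *\<^sub>R h) h)"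
        by (rule DERIV_continuous_on[OF has_field_derivative_at_within[OF grad_deriv_line[OF inU]]])
          (use t in auto)
      fix s assume "0 < s" "s < t"
      then show "((\<lambda>s. grad F (x + s *\<^sub>R h) h) has_real_derivative 0) (at s)"
        using grad_deriv_line[of x s h h] hess_zero_propagates[OF x xT _ _ zero, of s]
          inU[of s] t by simp
    qed
    then show ?thesis by simp
  qed
  let ?\<psi> = "\<lambda>s. F (x + s *\<^sub>R h) - s * grad F x h"
  have D: "(?\<psi> has_real_derivative grad F (x + s *\<^sub>R h) h - grad F x h) (at s)"
    if "0 \<le> s" "s \<le> T" for s
    using F_deriv_line[OF inU[OF that]] by (auto intro!: derivative_eq_intros)
  have "?\<psi> T = ?\<psi> 0"
  proof (rule DERIV_isconst_end[OF T0])
    show "continuous_on {0..T} ?\<psi>"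
      by (rule DERIV_continuous_on[OF has_field_derivative_at_within[OF D]]) auto
    show "(?\<psi> has_real_derivative 0) (at s)" if "0 < s" "s < T" for s
      using D[of s] const[of s] that by simp
  qed
  then show ?thesis by simp
qed simp

text \<open>
  A direction of zero curvature never leaves the domain: \<open>F\<close> is affine along it, so a boundary
  point reached in finite time would lie on the closed epigraph. Hence the admissible times
  form a subset of the half-line that is both open and closed.
\<close>

lemma ray_in_domain_of_hess_zero:
  assumes x: "x \<in> U" and zero: "hess F x h h = 0" and T: "0 \<le> T"
  shows "x + T *\<^sub>R h \<in> U"
proof -
  let ?S = "{0::real..}" and ?T = "{t \<in> {0..}. x + t *\<^sub>R h \<in> U}"
  have c1: "continuous_on ?S (\<lambda>t. x + t *\<^sub>R h)"
    and c2: "continuous_on ?S (\<lambda>t. (x + t *\<^sub>R h, F x + t * grad F x h))"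
    by (intro continuous_intros)+
  have "?T = ?S \<inter> (\<lambda>t. x + t *\<^sub>R h) -` U" by auto
  then have "openin (top_of_set ?S) ?T"
    using continuous_openin_preimage_gen[OF c1 open_domain] by simp
  moreover have "?T = ?S \<inter> (\<lambda>t. (x + t *\<^sub>R h, F x + t * grad F x h)) -` epigraph U F"
    using affine_of_hess_zero[OF x _ _ zero] by (auto simp: mem_epigraph)
  then have "closedin (top_of_set ?S) ?T"
    using continuous_closedin_preimage[OF c2 closed_epigraph] by simp
  moreover have "connected ?S" by (simp add: is_interval_connected is_interval_ci)
  ultimately have "?T = {} \<or> ?T = ?S" by (meson connected_clopen)
  moreover have "0 \<in> ?T" using x by simp
  ultimately have "?T = ?S" by blast
  then show ?thesis using T by auto
qed

end

section \<open>Logarithmically homogeneous barriers on a pointed cone\<close>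

locale log_homogeneous_barrier =
  fixes K :: "'a::euclidean_space set" and F :: "'a \<Rightarrow> real" and \<nu> :: real
  assumes cone_K: "closed_convex_pointed_cone K"
    and barrier: "normal_barrier K \<nu> F"
begin

sublocale self_concordant_function "interior K" F
  using barrier by unfold_locales (simp add: normal_barrier_def)

lemma nu_pos: "0 < \<nu>"
  and log_homogeneous: "x \<in> interior K \<Longrightarrow> 0 < \<tau> \<Longrightarrow> F (\<tau> *\<^sub>R x) = F x - \<nu> * ln \<tau>"
  using barrier by (auto simp: normal_barrier_def)

lemma closed_K: "closed K"
  and convex_K: "convex K"
  and scale_K: "x \<in> K \<Longrightarrow> 0 \<le> t \<Longrightarrow> t *\<^sub>R x \<in> K"
  using cone_K
  by (auto simp: closed_convex_pointed_cone_def cone_def)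

lemma pointed:
  assumes "x \<in> K" "- x \<in> K"
  shows "x = 0"
proof -
  have "x \<in> K \<inter> uminus ` K"
    using assms image_eqI[of x uminus "- x" K] by simp
  then show ?thesis using cone_K unfolding closed_convex_pointed_cone_def by blast
qed

lemma scale_interior:
  assumes "x \<in> interior K" "0 < t"
  shows "t *\<^sub>R x \<in> interior K"
proof (rule interior_maximal[THEN subsetD])
  show "open ((*\<^sub>R) t ` interior K)"
    using assms by (intro open_scaling) auto
  show "(*\<^sub>R) t ` interior K \<subseteq> K"
    using interior_subset scale_K assms(2) by fastforce
  show "t *\<^sub>R x \<in> (*\<^sub>R) t ` interior K"
    using assms by blast
qed

lemma add_interior:
  assumes "x \<in> interior K" "y \<in> interior K"
  shows "x + y \<in> interior K"
proof -
  have "(1/2) *\<^sub>R x + (1/2) *\<^sub>R y \<in> interior K"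
    using convexD[OF convex_domain assms, of "1/2" "1/2"] by simp
  from scale_interior[OF this, of 2] show ?thesis
    by (simp add: scaleR_add_right)
qed

lemma zero_not_interior: "0 \<notin> interior K"
proof
  assume "0 \<in> interior K"
  from log_homogeneous[OF this, of 2] show False
    using nu_pos by simp
qed

text \<open>
  The rescaled points \<open>(x + n h) / n\<close> of the ray stay in the closed cone and tend to \<open>h\<close>.
\<close>

lemma ray_direction_in_K:
  assumes "\<And>t. 0 \<le> t \<Longrightarrow> x + t *\<^sub>R h \<in> K"
  shows "h \<in> K"
proof (rule closed_sequentially[OF closed_K])
  show "(1 / real (Suc n)) *\<^sub>R (x + real (Suc n) *\<^sub>R h) \<in> K" for n
    by (intro scale_K assms) auto
  have "(\<lambda>n. (1 / real (Suc n)) *\<^sub>R x + h) \<longlonglongrightarrow> 0 *\<^sub>R x + h"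
    by (intro tendsto_intros LIMSEQ_Suc[OF lim_1_over_n])
  moreover have "(1 / real (Suc n)) *\<^sub>R (x + real (Suc n) *\<^sub>R h) = (1 / real (Suc n)) *\<^sub>R x + h" for n
    by (simp add: scaleR_add_right del: of_nat_Suc)
  ultimately show "(\<lambda>n. (1 / real (Suc n)) *\<^sub>R (x + real (Suc n) *\<^sub>R h)) \<longlonglongrightarrow> h"
    by simp
qed

text \<open>
  A direction \<open>h\<close> of zero curvature, together with \<open>-h\<close>, spans a line inside \<open>K\<close>; a pointed
  cone contains no line.
\<close>

lemma hess_definite:
  assumes x: "x \<in> interior K" and zero: "hess F x h h = 0"
  shows "h = 0"
proof (rule pointed)
  have "x + t *\<^sub>R k \<in> K" if "hess F x k k = 0" "0 \<le> t" for k t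
    using ray_in_domain_of_hess_zero[OF x that] interior_subset by blast
  moreover have "hess F x (- h) (- h) = 0"
    using zero by (simp add: blinfun.minus_left blinfun.minus_right)
  ultimately show "h \<in> K" "- h \<in> K"
    using zero ray_direction_in_K by blast+
qed

lemma hess_pos: "x \<in> interior K \<Longrightarrow> h \<noteq> 0 \<Longrightarrow> 0 < hess F x h h"
  using hess_nonneg[of x h] hess_definite[of x h] by fastforce

lemma grad_scale:
  assumes x: "x \<in> interior K" and t: "0 < t"
  shows "grad F (t *\<^sub>R x) = (1 / t) *\<^sub>R grad F x"
proof -
  have "((\<lambda>x. F (t *\<^sub>R x)) has_derivative (\<lambda>h. grad F (t *\<^sub>R x) (t *\<^sub>R h))) (at x)"
    by (rule has_derivative_compose[where f = "(*\<^sub>R) t", OF _ F_deriv[OF scale_interior[OF x t]]])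
      (auto intro!: derivative_eq_intros)
  moreover have "((\<lambda>x. F (t *\<^sub>R x)) has_derivative blinfun_apply (grad F x)) (at x)"
  proof (rule has_derivative_transform_within_open[OF _ open_domain x])
    show "((\<lambda>x. F x - \<nu> * ln t) has_derivative blinfun_apply (grad F x)) (at x)"
      using F_deriv[OF x] by (auto intro!: derivative_eq_intros)
  qed (use log_homogeneous t in auto)
  ultimately have "(\<lambda>h. grad F (t *\<^sub>R x) (t *\<^sub>R h)) = blinfun_apply (grad F x)"
    by (rule has_derivative_unique)
  then have "t * grad F (t *\<^sub>R x) h = grad F x h" for h
    by (simp add: fun_eq_iff blinfun.scaleR_right)
  then show ?thesis
    using t by (intro blinfun_eqI) (simp add: blinfun.scaleR_left field_simps)
qed

lemma hess_scale:
  assumes x: "x \<in> interior K" and t: "0 < t"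
  shows "hess F (t *\<^sub>R x) = (1 / t\<^sup>2) *\<^sub>R hess F x"
proof -
  have "((\<lambda>x. grad F (t *\<^sub>R x)) has_derivative (\<lambda>h. hess F (t *\<^sub>R x) (t *\<^sub>R h))) (at x)"
    by (rule has_derivative_compose[where f = "(*\<^sub>R) t", OF _ grad_deriv[OF scale_interior[OF x t]]])
      (auto intro!: derivative_eq_intros)
  moreover have "((\<lambda>x. grad F (t *\<^sub>R x)) has_derivative (\<lambda>h. (1 / t) *\<^sub>R hess F x h)) (at x)"
  proof (rule has_derivative_transform_within_open[OF _ open_domain x])
    show "((\<lambda>x. (1 / t) *\<^sub>R grad F x) has_derivative (\<lambda>h. (1 / t) *\<^sub>R hess F x h)) (at x)"
      using grad_deriv[OF x] by (auto intro!: derivative_eq_intros)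
  qed (use grad_scale t in auto)
  ultimately have "(\<lambda>h. hess F (t *\<^sub>R x) (t *\<^sub>R h)) = (\<lambda>h. (1 / t) *\<^sub>R hess F x h)"
    by (rule has_derivative_unique)
  then have "t *\<^sub>R hess F (t *\<^sub>R x) h = (1 / t) *\<^sub>R hess F x h" for h
    by (simp add: fun_eq_iff blinfun.scaleR_right)
  then have "(1 / t) *\<^sub>R (t *\<^sub>R hess F (t *\<^sub>R x) h) = (1 / t) *\<^sub>R ((1 / t) *\<^sub>R hess F x h)" for h
    by simp
  then show ?thesis
    using t by (intro blinfun_eqI) (simp add: blinfun.scaleR_left power2_eq_square)
qed

lemma grad_self:
  assumes x: "x \<in> interior K"
  shows "grad F x x = - \<nu>"
proof -
  have "((\<lambda>t. F (0 + t *\<^sub>R x)) has_real_derivative grad F x x) (at 1)"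
    using F_deriv_line[of 0 1 x] x by simp
  moreover have "((\<lambda>t. F (0 + t *\<^sub>R x)) has_real_derivative - \<nu>) (at 1)"
  proof (rule DERIV_cong_ev[THEN iffD2, OF refl _ refl])
    show "\<forall>\<^sub>F t in nhds 1. F (0 + t *\<^sub>R x) = F x - \<nu> * ln t"
      using eventually_nhds_in_open[of "{0<..}" "1::real"]
      by (auto elim!: eventually_mono simp: log_homogeneous[OF x])
    show "((\<lambda>t. F x - \<nu> * ln t) has_real_derivative - \<nu>) (at 1)"
      by (auto intro!: derivative_eq_intros)
  qed
  ultimately show ?thesis by (rule DERIV_unique)
qed

lemma hess_self_left:
  assumes x: "x \<in> interior K"
  shows "hess F x x h = - grad F x h"
proof -
  have "((\<lambda>t. grad F (0 + t *\<^sub>R x) h) has_real_derivative hess F x x h) (at 1)"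
    using grad_deriv_line[of 0 1 x h] x by simp
  moreover have "((\<lambda>t. grad F (0 + t *\<^sub>R x) h) has_real_derivative - grad F x h) (at 1)"
  proof (rule DERIV_cong_ev[THEN iffD2, OF refl _ refl])
    show "\<forall>\<^sub>F t in nhds 1. grad F (0 + t *\<^sub>R x) h = (1 / t) * grad F x h"
      using eventually_nhds_in_open[of "{0<..}" "1::real"]
      by (auto elim!: eventually_mono simp: grad_scale[OF x] blinfun.scaleR_left)
    show "((\<lambda>t. (1 / t) * grad F x h) has_real_derivative - grad F x h) (at 1)"
      by (auto intro!: derivative_eq_intros)
  qed
  ultimately show ?thesis by (rule DERIV_unique)
qed

lemma hess_self_right:
  assumes x: "x \<in> interior K"
  shows "hess F x h x = - grad F x h"
proof -
  have "((\<lambda>x. grad F x x) has_derivative (\<lambda>h. grad F x h + hess F x h x)) (at x)"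
    using bounded_bilinear.FDERIV[OF bounded_bilinear_blinfun_apply grad_deriv[OF x] has_derivative_ident]
    by simp
  moreover have "((\<lambda>x. grad F x x) has_derivative (\<lambda>h. 0)) (at x)"
    by (rule has_derivative_transform_within_open[OF has_derivative_const open_domain x])
      (simp add: grad_self)
  ultimately have "(\<lambda>h. grad F x h + hess F x h x) = (\<lambda>h. 0)"
    by (rule has_derivative_unique)
  then show ?thesis by (simp add: fun_eq_iff add_eq_0_iff)
qed

text \<open>
  The Cauchy--Schwarz inequality for the pair \<open>x, h\<close>. On the span of \<open>x\<close> and \<open>h\<close> homogeneity
  already makes the Hessian form symmetric, so its nonnegativity at one combination suffices.
\<close>

lemma grad_square_le:
  assumes x: "x \<in> interior K"
  shows "(grad F x h)\<^sup>2 \<le> \<nu> * hess F x h h"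
proof -
  let ?g = "grad F x h"
  \<comment> \<open>The combination minimises \<open>r \<mapsto> D\<^sup>2F(x)[r x + \<nu> h]\<^sup>2\<close>, since \<open>D\<^sup>2F(x)[x, x] = \<nu>\<close>.\<close>
  have "0 \<le> hess F x (?g *\<^sub>R x + \<nu> *\<^sub>R h) (?g *\<^sub>R x + \<nu> *\<^sub>R h)"
    by (rule hess_nonneg[OF x])
  also have "\<dots> = ?g\<^sup>2 * \<nu> - 2 * \<nu> * ?g\<^sup>2 + \<nu>\<^sup>2 * hess F x h h"
    by (simp add: blinfun.add_left blinfun.add_right blinfun.scaleR_left blinfun.scaleR_right
        hess_self_left[OF x] hess_self_right[OF x] grad_self[OF x] power2_eq_square algebra_simps)
  also have "\<dots> = \<nu> * (\<nu> * hess F x h h - ?g\<^sup>2)"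
    by (simp add: power2_eq_square algebra_simps)
  finally show ?thesis
    using nu_pos by (simp add: zero_le_mult_iff)
qed

lemma lambda_g_square_le:
  assumes x: "x \<in> interior K"
  shows "(lambda_g F A x)\<^sup>2 \<le> ereal \<nu>"
proof -
  have "lambda_g F A x \<le> ereal (sqrt \<nu>)"
    unfolding lambda_g_def
  proof (rule SUP_least)
    fix h assume "h \<in> {h. A h = 0 \<and> hess F x h h \<le> 1}"
    then have "hess F x h h \<le> 1" by blast
    then have "\<nu> * hess F x h h \<le> \<nu>" using nu_pos by simp
    then have "(grad F x h)\<^sup>2 \<le> \<nu>"
      using grad_square_le[OF x, of h] by linarith
    then show "ereal (grad F x h) \<le> ereal (sqrt \<nu>)"
      by (simp add: real_le_rsqrt)
  qed
  moreover have "0 \<le> lambda_g F A x"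
    unfolding lambda_g_def by (rule SUP_upper2[of 0]) (auto simp: blinfun.zero_left)
  ultimately obtain l where l: "lambda_g F A x = ereal l" "0 \<le> l" "l \<le> sqrt \<nu>"
    by (cases "lambda_g F A x") auto
  then have "l\<^sup>2 \<le> \<nu>"
    using power_mono[of l "sqrt \<nu>" 2] nu_pos by simp
  then show ?thesis by (simp add: l)
qed

text \<open>
  The supremum is tested with \<open>d\<close>, normalised to unit local length and oriented uphill.
\<close>

lemma lambda_g_square_ge:
  fixes A :: "'a \<Rightarrow>\<^sub>L (real ^ 'm)"
  assumes x: "x \<in> interior K" and d: "A d = 0" "d \<noteq> 0"
  shows "ereal ((grad F x d)\<^sup>2 / hess F x d d) \<le> (lambda_g F A x)\<^sup>2"
proof -
  define q where "q = hess F x d d"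
  have q: "0 < q" unfolding q_def by (rule hess_pos[OF x d(2)])
  define h where "h = (sgn (grad F x d) / sqrt q) *\<^sub>R d"
  have "grad F x h = \<bar>grad F x d\<bar> / sqrt q"
    by (simp add: h_def blinfun.scaleR_right abs_sgn mult.commute)
  moreover have "hess F x h h = (sgn (grad F x d))\<^sup>2"
    using q by (simp add: h_def blinfun.scaleR_right blinfun.scaleR_left power2_eq_square
        flip: q_def)
  then have "hess F x h h \<le> 1"
    by (simp add: sgn_if)
  ultimately have *: "ereal (\<bar>grad F x d\<bar> / sqrt q) \<le> lambda_g F A x"
    unfolding lambda_g_def using d(1)
    by (intro SUP_upper2[of h]) (auto simp: h_def blinfun.scaleR_right)
  then have "(ereal (\<bar>grad F x d\<bar> / sqrt q))\<^sup>2 \<le> (lambda_g F A x)\<^sup>2"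
    unfolding power2_eq_square using q by (intro ereal_mult_mono order_trans[OF _ *]) auto
  then show ?thesis
    using q by (simp add: q_def power_divide)
qed

lemma nu_g_le: "nu_g K F A b \<le> ereal \<nu>"
  unfolding nu_g_def by (rule SUP_least) (simp add: lambda_g_square_le)

text \<open>
  A direction \<open>d \<in> int K\<close> in the kernel of \<open>A\<close> lets the feasible point move to infinity. The
  ratio \<open>r\<close> is invariant under scaling of the base point, so the feasible point
  \<open>x + d/t\<close> may be replaced by \<open>d + t x\<close>, which tends to \<open>d\<close> as \<open>t\<close> decreases to \<open>0\<close>.
\<close>

lemma nu_g_ge:
  fixes A :: "'a \<Rightarrow>\<^sub>L (real ^ 'm)"
  assumes x: "x \<in> interior K" "A x = b" and d: "d \<in> interior K" "A d = 0"
  shows "ereal \<nu> \<le> nu_g K F A b"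
proof -
  define r where "r = (\<lambda>z. (grad F z d)\<^sup>2 / hess F z d d)"
  have d0: "d \<noteq> 0" using d(1) zero_not_interior by blast
  have le: "ereal (r (d + t *\<^sub>R x)) \<le> nu_g K F A b" if t: "0 < t" for t
  proof -
    let ?p = "d + t *\<^sub>R x" and ?x = "x + (1 / t) *\<^sub>R d"
    have p: "?p \<in> interior K"
      by (intro add_interior scale_interior x d t)
    have x': "?x \<in> interior K"
      using t by (intro add_interior scale_interior x d) auto
    have "?x = (1 / t) *\<^sub>R ?p" using t by (simp add: scaleR_add_right)
    then have "r ?x = r ?p"
      using t grad_scale[OF p, of "1 / t"] hess_scale[OF p, of "1 / t"]
      by (simp add: r_def blinfun.scaleR_left power_mult_distrib power_one_over)
    moreover have "ereal (r ?x) \<le> (lambda_g F A ?x)\<^sup>2"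
      unfolding r_def by (rule lambda_g_square_ge[OF x' d(2) d0])
    moreover have "(lambda_g F A ?x)\<^sup>2 \<le> nu_g K F A b"
      unfolding nu_g_def using x' x(2) d(2)
      by (intro SUP_upper) (auto simp: blinfun.add_right blinfun.scaleR_right)
    ultimately show ?thesis by simp
  qed
  have "isCont r d"
  proof -
    have "isCont (grad F) d" "isCont (hess F) d"
      using continuous_on_grad continuous_on_hess d(1) open_domain
      by (auto simp: continuous_on_eq_continuous_at)
    then show ?thesis
      unfolding r_def using hess_pos[OF d(1) d0] by (intro continuous_intros) auto
  qed
  moreover have "r d = \<nu>"
    using nu_pos by (simp add: r_def grad_self[OF d(1)] hess_self_left[OF d(1)] power2_eq_square)
  moreover have "((\<lambda>t. d + t *\<^sub>R x) \<longlongrightarrow> d + 0 *\<^sub>R x) (at_right 0)"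
    by (intro tendsto_intros)
  ultimately have "((\<lambda>t. r (d + t *\<^sub>R x)) \<longlongrightarrow> \<nu>) (at_right 0)"
    using isCont_tendsto_compose[of d r "\<lambda>t. d + t *\<^sub>R x" "at_right 0"] by simp
  then have "((\<lambda>t. ereal (r (d + t *\<^sub>R x))) \<longlongrightarrow> ereal \<nu>) (at_right 0)"
    by simp
  then show ?thesis
    by (rule tendsto_upperbound)
      (auto simp: le intro: eventually_mono[OF eventually_at_right_less])
qed

section \<open>The gradient map and the conjugate barrier\<close>

text \<open>
  A functional that grows linearly on \<open>K\<close> makes \<open>s + F\<close> attain its minimum. On the slice
  \<open>s x = \<nu>\<close> the sublevel sets of \<open>F\<close> are bounded, and they are closed because the epigraph is,
  so \<open>F\<close> has a minimiser \<open>z\<close> there. Along each ray homogeneity and \<open>ln \<tau> \<le> \<tau> - 1\<close> show that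
  \<open>s + F\<close> is smallest exactly on this slice; hence \<open>z\<close> is a minimiser over the whole interior.
\<close>

lemma gradient_attains:
  fixes s :: "'a \<Rightarrow>\<^sub>L real"
  assumes ne: "interior K \<noteq> {}" and \<delta>: "0 < \<delta>" and s: "\<And>x. x \<in> K \<Longrightarrow> \<delta> * norm x \<le> s x"
  shows "\<exists>x\<in>interior K. grad F x = - s"
proof -
  have s_pos: "0 < s x" if "x \<in> interior K" for x
  proof -
    have "x \<noteq> 0" using that zero_not_interior by blast
    then have "0 < \<delta> * norm x" using \<delta> by simp
    then show ?thesis using s[of x] that interior_subset by fastforce
  qed
  have scaled: "(\<nu> / s x) *\<^sub>R x \<in> interior K" "s ((\<nu> / s x) *\<^sub>R x) = \<nu>" if "x \<in> interior K" for x
    using scale_interior[OF that, of "\<nu> / s x"] s_pos[OF that] nu_pos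
    by (simp_all add: blinfun.scaleR_right)
  obtain p where p: "p \<in> interior K" "s p = \<nu>"
    using ne scaled by blast
  define C where "C = {x \<in> interior K. F x \<le> F p} \<inter> {x. s x = \<nu>}"
  have "compact C"
  proof -
    have "closed {x \<in> interior K. F x \<le> F p}"
    proof -
      have "{x \<in> interior K. F x \<le> F p} = (\<lambda>x. (x, F p)) -` epigraph (interior K) F"
        by (auto simp: mem_epigraph)
      moreover have "closed ((\<lambda>x. (x, F p)) -` epigraph (interior K) F)"
        by (intro closed_vimage closed_epigraph continuous_intros)
      ultimately show ?thesis by simp
    qed
    then have "closed C"
      unfolding C_def
      by (intro closed_Int closed_Collect_eq continuous_intros) auto
    moreover have "norm x \<le> \<nu> / \<delta>" if "x \<in> C" for x
      using that s[of x] interior_subset \<delta> by (auto simp: C_def field_simps)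
    then have "bounded C" by (auto simp: bounded_iff)
    ultimately show ?thesis by (simp add: compact_eq_bounded_closed)
  qed
  moreover have "p \<in> C" using p by (simp add: C_def)
  moreover have "continuous_on C F"
    by (rule continuous_on_subset[OF continuous_on_F]) (auto simp: C_def)
  ultimately obtain z where z: "z \<in> C" "\<And>x. x \<in> C \<Longrightarrow> F z \<le> F x"
    using continuous_attains_inf[of C F] by blast
  have zK: "z \<in> interior K" and sz: "s z = \<nu>" using z(1) by (auto simp: C_def)
  have z_min_slice: "F z \<le> F x" if "x \<in> interior K" "s x = \<nu>" for x
    using z that by (cases "F x \<le> F p") (auto simp: C_def)
  have z_min: "s z + F z \<le> s x + F x" if x: "x \<in> interior K" for x
  proof -
    define \<tau> where "\<tau> = s x / \<nu>"
    have \<tau>: "0 < \<tau>" using s_pos[OF x] nu_pos by (simp add: \<tau>_def)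
    let ?u = "(\<nu> / s x) *\<^sub>R x"
    have "x = \<tau> *\<^sub>R ?u" using s_pos[OF x] nu_pos by (simp add: \<tau>_def)
    then have "F x = F ?u - \<nu> * ln \<tau>"
      using log_homogeneous[OF scaled(1)[OF x] \<tau>] by simp
    moreover have "F z \<le> F ?u" by (rule z_min_slice[OF scaled[OF x]])
    moreover have "\<nu> * ln \<tau> \<le> \<nu> * (\<tau> - 1)"
      using ln_le_minus_one[OF \<tau>] nu_pos by simp
    moreover have "s x = \<nu> * \<tau>" using nu_pos by (simp add: \<tau>_def)
    ultimately show ?thesis by (simp add: sz algebra_simps)
  qed
  have "((\<lambda>x. s x + F x) has_derivative (\<lambda>h. s h + grad F z h)) (at z)"
    using F_deriv[OF zK] by (auto intro!: derivative_eq_intros)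
  then have "(\<lambda>h. s h + grad F z h) = (\<lambda>h. 0)"
    by (rule differential_zero_maxmin[OF zK open_domain]) (use z_min in auto)
  then have "grad F z = - s"
    by (intro blinfun_eqI) (simp add: fun_eq_iff blinfun.minus_left eq_neg_iff_add_eq_0 add.commute)
  then show ?thesis using zK by blast
qed

lemma dual_barrier_eq:
  assumes x: "x \<in> interior K" and g: "grad F x = - s"
  shows "dual_barrier K F s = - s x - F x"
  unfolding dual_barrier_def
proof (rule cSup_eq_maximum)
  show "- s x - F x \<in> (\<lambda>x. - s x - F x) ` interior K" using x by blast
  fix r assume "r \<in> (\<lambda>x. - s x - F x) ` interior K"
  then obtain y where y: "y \<in> interior K" "r = - s y - F y" by blast
  show "r \<le> - s x - F x"
    using above_tangent[OF x y(1)] by (simp add: y(2) g blinfun.minus_left blinfun.diff_right)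
qed

text \<open>
  The Hessian being positive definite, the slope strictly increases along every segment.
\<close>

lemma inj_on_grad: "inj_on (grad F) (interior K)"
proof (rule inj_onI, rule ccontr)
  fix x y assume xy: "x \<in> interior K" "y \<in> interior K" "grad F x = grad F y" "x \<noteq> y"
  let ?h = "y - x"
  let ?g = "\<lambda>t. grad F (x + t *\<^sub>R ?h) ?h"
  have "?g 0 < ?g 1"
  proof (rule DERIV_pos_imp_increasing[where f = ?g])
    fix t :: real assume t: "0 \<le> t" "t \<le> 1"
    have "x + t *\<^sub>R ?h \<in> interior K"
      using segment_in_domain[of x 1 ?h t] xy t by simp
    then show "\<exists>D. (?g has_real_derivative D) (at t) \<and> 0 < D"
      using grad_deriv_line hess_pos xy(4) by (metis right_minus_eq)
  qed simp
  then show False using xy(3) by simp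
qed

definition grad_inverse :: "('a \<Rightarrow>\<^sub>L real) \<Rightarrow> 'a" where
  "grad_inverse = inv_into (interior K) (grad F)"

lemma grad_inverse_grad: "x \<in> interior K \<Longrightarrow> grad_inverse (grad F x) = x"
  by (simp add: grad_inverse_def inj_on_grad)

text \<open>
  The inverse function theorem for \<open>\<nabla>F\<close>. The operator norm does not make the dual space
  Euclidean, so the theorem is applied to \<open>R \<circ> \<nabla>F\<close> with the Riesz isomorphism \<open>R\<close>, which maps
  \<open>int K\<close> into \<open>'a\<close> itself.
\<close>

lemma grad_inverse_has_derivative:
  assumes x: "x \<in> interior K"
  obtains D where "(grad_inverse has_derivative D) (at (grad F x))"
    and "\<And>\<sigma>. hess F x (D \<sigma>) = \<sigma>"
proof -
  define R :: "('a \<Rightarrow>\<^sub>L real) \<Rightarrow> 'a" where "R = (\<lambda>s. \<Sum>b\<in>Basis. s b *\<^sub>R b)"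
  have R_inner: "R s \<bullet> v = s v" for s v
  proof -
    have "R s \<bullet> v = (\<Sum>b\<in>Basis. (v \<bullet> b) * s b)"
      by (simp add: R_def inner_sum_left inner_commute[of v] mult.commute)
    also have "\<dots> = s (\<Sum>b\<in>Basis. (v \<bullet> b) *\<^sub>R b)"
      by (simp add: blinfun.sum_right blinfun.scaleR_right)
    finally show ?thesis by (simp add: euclidean_representation)
  qed
  have RI: "blinfun_inner_right (R s) = s" for s
    by (intro blinfun_eqI) (simp add: R_inner)
  have bl_R: "bounded_linear R"
    unfolding R_def by (intro bounded_linear_sum bounded_linear_scaleR_const blinfun.bounded_linear_left)
  let ?f = "R \<circ> grad F" and ?f' = "R \<circ> blinfun_apply (hess F x)"
  have f': "(?f has_derivative ?f') (at x)"
    using bounded_linear.has_derivative[OF bl_R grad_deriv[OF x]] by (simp add: o_def)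
  have "linear ?f'" using f' has_derivative_linear by blast
  moreover have "inj ?f'"
  proof (subst linear_injective_0[OF \<open>linear ?f'\<close>], intro allI impI)
    fix h assume "?f' h = 0"
    then have "hess F x h h = 0" using R_inner[of "hess F x h" h] by simp
    then show "h = 0" by (rule hess_definite[OF x])
  qed
  ultimately obtain g' where g': "linear g'" "?f' \<circ> g' = id"
    using linear_injective_isomorphism[of ?f'] by (auto simp: fun_eq_iff)
  have "((grad_inverse \<circ> blinfun_inner_right) has_derivative g') (at (?f x))"
  proof (rule has_derivative_inverse_strong[OF open_domain x _ _ f' g'(2)])
    show "continuous_on (interior K) ?f"
      unfolding o_def
      by (rule bounded_linear.continuous_on[OF bl_R continuous_on_grad])
    show "(grad_inverse \<circ> blinfun_inner_right) (?f y) = y" if "y \<in> interior K" for y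
      using that by (simp add: RI grad_inverse_grad)
  qed
  then have "((\<lambda>s. (grad_inverse \<circ> blinfun_inner_right) (R s)) has_derivative (\<lambda>\<sigma>. g' (R \<sigma>)))
      (at (grad F x))"
    by (intro has_derivative_compose[OF bounded_linear_imp_has_derivative[OF bl_R]])
      (simp only: o_def)
  then have "(grad_inverse has_derivative (\<lambda>\<sigma>. g' (R \<sigma>))) (at (grad F x))"
    by (simp add: RI)
  moreover have "hess F x (g' (R \<sigma>)) = \<sigma>" for \<sigma>
  proof -
    have "R (hess F x (g' (R \<sigma>))) = R \<sigma>"
      using fun_cong[OF g'(2), of "R \<sigma>"] by simp
    then show ?thesis by (metis RI)
  qed
  ultimately show thesis by (rule that)
qed

section \<open>The dual barrier on the dual feasible set\<close>

lemma dual_adjoint_has_derivative: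
  "(dual_adjoint A has_derivative dual_adjoint A) (at y)"
proof -
  have "bounded_linear (\<lambda>y. blinfun_inner_right y o\<^sub>L A)"
    by (rule bounded_linear_compose[OF
          bounded_bilinear.bounded_linear_left[OF bounded_bilinear_blinfun_compose]
          bounded_linear_blinfun_inner_right])
  then show ?thesis
    by (intro bounded_linear_imp_has_derivative) (simp add: dual_adjoint_def[abs_def])
qed

text \<open>
  By duality \<open>\<zeta>(y) = (A\<^sup>*y - c)(\<xi>(y)) - F(\<xi>(y))\<close>, where the maximiser \<open>\<xi>(y)\<close> is the preimage of
  \<open>A\<^sup>*y - c\<close> under \<open>\<nabla>F\<close>. In the gradient the terms containing the derivative of
  \<open>\<xi>\<close> cancel, because \<open>\<xi>(y)\<close> is a stationary point; that derivative \<open>u\<close> therefore appears only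
  in the Hessian.
\<close>

lemma zeta_derivatives:
  fixes A :: "'a \<Rightarrow>\<^sub>L (real ^ 'm)"
  assumes Y: "open Y" "y \<in> Y"
    and solvable: "\<And>y. y \<in> Y \<Longrightarrow> \<exists>x\<in>interior K. grad F x = - (c - dual_adjoint A y)"
  obtains x u where "x \<in> interior K"
    and "grad (zeta K F A c) y = blinfun_inner_right (A x)"
    and "\<And>\<eta>. hess F x (u \<eta>) = dual_adjoint A \<eta>"
    and "\<And>\<eta>. hess (zeta K F A c) y \<eta> = blinfun_inner_right (A (u \<eta>))"
proof -
  let ?\<zeta> = "zeta K F A c"
  define \<xi> where "\<xi> = (\<lambda>y. grad_inverse (dual_adjoint A y - c))"
  have \<xi>: "\<xi> y \<in> interior K" "grad F (\<xi> y) = dual_adjoint A y - c" if y: "y \<in> Y" for y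
  proof -
    obtain x where x: "x \<in> interior K" "grad F x = dual_adjoint A y - c"
      using solvable[OF y] by auto
    have "\<xi> y = x" using grad_inverse_grad[OF x(1)] by (simp add: \<xi>_def x(2))
    then show "\<xi> y \<in> interior K" "grad F (\<xi> y) = dual_adjoint A y - c"
      using x by simp_all
  qed
  have \<xi>_deriv: "\<exists>u. (\<xi> has_derivative u) (at y) \<and> (\<forall>\<eta>. hess F (\<xi> y) (u \<eta>) = dual_adjoint A \<eta>)"
    if y: "y \<in> Y" for y
  proof -
    obtain D where D: "(grad_inverse has_derivative D) (at (grad F (\<xi> y)))"
      "\<And>\<sigma>. hess F (\<xi> y) (D \<sigma>) = \<sigma>"
      by (rule grad_inverse_has_derivative[OF \<xi>(1)[OF y]]) blast
    have "((\<lambda>y. dual_adjoint A y - c) has_derivative dual_adjoint A) (at y)"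
      using has_derivative_diff[OF dual_adjoint_has_derivative has_derivative_const] by simp
    from has_derivative_compose[OF this, of grad_inverse D] D(1) \<xi>(2)[OF y]
    have "(\<xi> has_derivative (\<lambda>\<eta>. D (dual_adjoint A \<eta>))) (at y)"
      by (simp add: \<xi>_def)
    then show ?thesis using D(2) by blast
  qed
  have grad_\<zeta>: "grad ?\<zeta> y = blinfun_inner_right (A (\<xi> y))" if y: "y \<in> Y" for y
  proof (rule grad_eqI, rule has_derivative_transform_within_open[OF _ Y(1) y])
    show "(dual_adjoint A z - c) (\<xi> z) - F (\<xi> z) = ?\<zeta> z" if "z \<in> Y" for z
    proof -
      have "grad F (\<xi> z) = - (c - dual_adjoint A z)" using \<xi>(2)[OF that] by simp
      from dual_barrier_eq[OF \<xi>(1)[OF that] this] show ?thesis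
        by (simp add: zeta_def blinfun.diff_left)
    qed
    have inner_right: "blinfun_apply (blinfun_inner_right v) = (\<lambda>\<eta>. \<eta> \<bullet> v)" for v :: "real ^ 'm"
      by (simp add: fun_eq_iff inner_commute)
    obtain u where u: "(\<xi> has_derivative u) (at y)" using \<xi>_deriv[OF y] by blast
    have "((\<lambda>y. dual_adjoint A y - c) has_derivative dual_adjoint A) (at y)"
      using has_derivative_diff[OF dual_adjoint_has_derivative has_derivative_const] by simp
    from has_derivative_diff[OF
        bounded_bilinear.FDERIV[OF bounded_bilinear_blinfun_apply this u]
        has_derivative_compose[OF u F_deriv[OF \<xi>(1)[OF y]]]]
    show "((\<lambda>z. (dual_adjoint A z - c) (\<xi> z) - F (\<xi> z)) has_derivative
        blinfun_apply (blinfun_inner_right (A (\<xi> y)))) (at y)"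
      by (simp add: \<xi>(2)[OF y] dual_adjoint_apply inner_right del: blinfun_inner_right.rep_eq)
  qed
  obtain u where u: "(\<xi> has_derivative u) (at y)"
    "\<And>\<eta>. hess F (\<xi> y) (u \<eta>) = dual_adjoint A \<eta>"
    using \<xi>_deriv[OF Y(2)] by blast
  let ?B = "\<lambda>\<eta>. blinfun_inner_right (A (u \<eta>))"
  have "((\<lambda>y. blinfun_inner_right (A (\<xi> y))) has_derivative ?B) (at y)"
    by (rule bounded_linear.has_derivative[OF bounded_linear_blinfun_inner_right
          bounded_linear.has_derivative[OF blinfun.bounded_linear_right u(1)]])
  then have B: "(grad ?\<zeta> has_derivative ?B) (at y)"
    by (rule has_derivative_transform_within_open[OF _ Y]) (simp add: grad_\<zeta>)
  then have app: "blinfun_apply (Blinfun ?B) = ?B"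
    by (intro bounded_linear_Blinfun_apply has_derivative_bounded_linear)
  have "hess ?\<zeta> y = Blinfun ?B"
    by (rule hess_eqI) (simp add: app B)
  then have "hess ?\<zeta> y \<eta> = ?B \<eta>" for \<eta> by (simp add: app)
  then show thesis using that \<xi>(1)[OF Y(2)] grad_\<zeta>[OF Y(2)] u(2) by blast
qed

text \<open>
  The Hessian form of \<open>\<zeta>\<close> at \<open>\<eta>\<close> is that of \<open>F\<close> at \<open>u(\<eta>)\<close>, hence positive definite when \<open>A\<^sup>*\<close>
  is injective. So \<open>inv\<close> yields a genuine preimage \<open>w\<close> of the gradient, for which the slope
  \<open>-DF(x)[u(w)]\<close> and the curvature \<open>D\<^sup>2F(x)[u(w), u(w)]\<close> coincide.
\<close>

lemma newton_decrement_zeta_le: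
  fixes A :: "'a \<Rightarrow>\<^sub>L (real ^ 'm)"
  assumes inj: "inj (dual_adjoint A)" and Y: "open Y" "y \<in> Y"
    and solvable: "\<And>y. y \<in> Y \<Longrightarrow> \<exists>x\<in>interior K. grad F x = - (c - dual_adjoint A y)"
  shows "grad (zeta K F A c) y
      (inv (blinfun_apply (hess (zeta K F A c) y)) (grad (zeta K F A c) y)) \<le> \<nu>"
proof -
  let ?g = "grad (zeta K F A c) y" and ?H = "hess (zeta K F A c) y"
  obtain x u where x: "x \<in> interior K" and g: "?g = blinfun_inner_right (A x)"
    and u: "\<And>\<eta>. hess F x (u \<eta>) = dual_adjoint A \<eta>"
    and H: "\<And>\<eta>. ?H \<eta> = blinfun_inner_right (A (u \<eta>))"
    by (rule zeta_derivatives[OF Y solvable]) blast+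
  have H_form: "?H \<eta> \<eta> = hess F x (u \<eta>) (u \<eta>)" for \<eta>
    by (simp add: H u dual_adjoint_apply inner_commute)
  have "surj (blinfun_apply ?H)"
  proof -
    have lin: "linear (\<lambda>\<eta>. A (u \<eta>))"
    proof -
      \<comment> \<open>Linearity is inherited from the Hessian of \<open>\<zeta>\<close>, which is represented by \<open>A u(\<eta>)\<close>.\<close>
      have eq: "A (u \<eta>) = (\<Sum>b\<in>Basis. ?H \<eta> b *\<^sub>R b)" for \<eta>
        by (simp add: H euclidean_representation)
      show ?thesis
        by (rule linearI) (simp_all add: eq blinfun.add_right blinfun.add_left
            blinfun.scaleR_right blinfun.scaleR_left scaleR_left_distrib sum.distrib scaleR_sum_right)
    qed
    moreover have "inj (\<lambda>\<eta>. A (u \<eta>))"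
    proof (subst linear_injective_0[OF lin], intro allI impI)
      fix \<eta> assume "A (u \<eta>) = 0"
      then have "u \<eta> = 0" using H_form[of \<eta>] hess_definite[OF x] by (simp add: H)
      then have "dual_adjoint A \<eta> = dual_adjoint A 0"
        using u[of \<eta>] by (simp add: blinfun.zero_right dual_adjoint_def
            linear_0[OF bounded_linear.linear[OF bounded_linear_blinfun_inner_right]])
      then show "\<eta> = 0" using inj by (simp add: inj_eq)
    qed
    ultimately have surj: "surj (\<lambda>\<eta>. A (u \<eta>))"
      by (simp add: linear_injective_imp_surjective)
    show ?thesis
    proof (rule surjI[of _ "\<lambda>s. SOME \<eta>. ?H \<eta> = s"], rule someI_ex)
      fix s :: "(real ^ 'm) \<Rightarrow>\<^sub>L real"
      define v where "v = (\<Sum>b\<in>Basis. s b *\<^sub>R b)"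
      obtain \<eta> where \<eta>: "A (u \<eta>) = v" using surj by (metis surjD)
      have "?H \<eta> = s"
      proof (rule blinfun_euclidean_eqI)
        fix b :: "real ^ 'm" assume "b \<in> Basis"
        then show "?H \<eta> b = s b" by (simp add: H \<eta> v_def inner_sum_left_Basis)
      qed
      then show "\<exists>\<eta>. ?H \<eta> = s" by blast
    qed
  qed
  define w where "w = inv (blinfun_apply ?H) ?g"
  have w: "?H w = ?g" unfolding w_def by (rule surj_f_inv_f[OF \<open>surj _\<close>])
  have "?g w = hess F x (u w) x"
    by (simp add: g u dual_adjoint_apply inner_commute)
  then have "(?g w)\<^sup>2 = (grad F x (u w))\<^sup>2"
    by (simp add: hess_self_right[OF x])
  also have "\<dots> \<le> \<nu> * hess F x (u w) (u w)" by (rule grad_square_le[OF x])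
  also have "\<dots> = \<nu> * ?g w" by (simp add: w flip: H_form)
  finally have "?g w * ?g w \<le> \<nu> * ?g w" by (simp add: power2_eq_square)
  then show ?thesis
    unfolding w_def[symmetric] using nu_pos
    by (cases "?g w \<le> 0") (auto simp: not_le)
qed

end

section \<open>Consequences of strict and bounded dual feasibility\<close>

text \<open>
  Subtracting from \<open>s\<close> the small functional \<open>e \<langle>x/|x|, \<cdot>\<rangle>\<close> leaves it in the dual cone, and at
  \<open>x\<close> this functional has the value \<open>e |x|\<close>.
\<close>

lemma interior_dual_cone_coercive:
  assumes "s \<in> interior (dual_cone K)"
  obtains \<delta> where "0 < \<delta>" "\<And>x. x \<in> K \<Longrightarrow> \<delta> * norm x \<le> s x"
proof -
  obtain e where e: "0 < e" "cball s e \<subseteq> dual_cone K"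
    using assms mem_interior_cball by blast
  have "e * norm x \<le> s x" if x: "x \<in> K" for x
  proof -
    let ?r = "e *\<^sub>R blinfun_inner_right (sgn x)"
    have "norm ?r \<le> e"
    proof -
      have "norm (blinfun_inner_right (sgn x)) \<le> 1"
        by (rule norm_blinfun_bound)
          (auto intro: order_trans[OF Cauchy_Schwarz_ineq2] simp: norm_sgn)
      then show ?thesis using e(1) by simp
    qed
    then have "s - ?r \<in> cball s e" by (simp add: dist_norm)
    then have "s - ?r \<in> dual_cone K" using e(2) by blast
    then have "0 \<le> (s - ?r) x" using x by (simp add: dual_cone_def)
    moreover have "sgn x \<bullet> x = norm x"
      by (cases "x = 0")
        (simp_all add: sgn_div_norm power2_norm_eq_inner[symmetric] power2_eq_square)
    ultimately show ?thesis
      by (simp add: blinfun.diff_left blinfun.scaleR_left)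
  qed
  then show thesis using e(1) that by blast
qed

text \<open>
  Extending the segment from the strictly feasible \<open>z\<close> slightly beyond \<open>y\<close> stays in the feasible
  set, so the slack at \<open>y\<close> is a convex combination of an element of the dual cone and, with
  positive weight, the coercive slack at \<open>z\<close>.
\<close>

lemma interior_feasible_y_coercive:
  assumes y: "y \<in> interior (feasible_y K A c)"
    and slater: "c - dual_adjoint A z \<in> interior (dual_cone K)"
  obtains \<delta> where "0 < \<delta>" "\<And>x. x \<in> K \<Longrightarrow> \<delta> * norm x \<le> (c - dual_adjoint A y) x"
proof -
  obtain \<delta> where \<delta>: "0 < \<delta>" "\<And>x. x \<in> K \<Longrightarrow> \<delta> * norm x \<le> (c - dual_adjoint A z) x"
    using interior_dual_cone_coercive[OF slater] by blast
  obtain r where r: "0 < r" "cball y r \<subseteq> feasible_y K A c"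
    using y mem_interior_cball by blast
  \<comment> \<open>The summand \<open>1\<close> avoids a division by zero in the case \<open>y = z\<close>.\<close>
  define e where "e = r / (norm (y - z) + 1)"
  have n: "0 < norm (y - z) + 1" using norm_ge_zero[of "y - z"] by linarith
  then have e: "0 < e" using r(1) by (simp add: e_def)
  have "norm (e *\<^sub>R (y - z)) \<le> e * (norm (y - z) + 1)"
    using e by simp
  also have "\<dots> = r" using n by (simp add: e_def)
  finally have "y + e *\<^sub>R (y - z) \<in> feasible_y K A c"
    using r(2) by (auto simp: dist_norm)
  then have "0 \<le> (c - dual_adjoint A (y + e *\<^sub>R (y - z))) x" if "x \<in> K" for x
    using that by (simp add: feasible_y_def dual_cone_def)
  then have *: "e * (c - dual_adjoint A z) x \<le> (1 + e) * (c - dual_adjoint A y) x" if "x \<in> K" for x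
    using that by (fastforce simp: blinfun.diff_left dual_adjoint_apply inner_diff_left
        inner_add_left algebra_simps)
  have "e * \<delta> / (1 + e) * norm x \<le> (c - dual_adjoint A y) x" if "x \<in> K" for x
  proof -
    have "e * (\<delta> * norm x) \<le> (1 + e) * (c - dual_adjoint A y) x"
      using mult_left_mono[OF \<delta>(2)[OF that], of e] *[OF that] e by linarith
    then show ?thesis using e by (simp add: field_simps)
  qed
  moreover have "0 < e * \<delta> / (1 + e)" using e \<delta>(1) by simp
  ultimately show thesis using that by blast
qed

text \<open>
  If \<open>0 \<notin> A(int K)\<close>, a separating vector \<open>a\<close> satisfies \<open>A\<^sup>*a \<in> K\<^sup>*\<close>, and \<open>-a\<close> is then a
  recession direction of the dual feasible set.
\<close>

lemma kernel_meets_interior: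
  fixes K :: "'a::euclidean_space set" and A :: "'a \<Rightarrow>\<^sub>L (real ^ 'm)"
  assumes K: "closed K" "convex K" "interior K \<noteq> {}"
    and bounded: "bounded (feasible_y K A c)" and y: "y \<in> feasible_y K A c"
  shows "\<exists>d\<in>interior K. A d = 0"
proof (rule ccontr)
  assume "\<not> ?thesis"
  then have "0 \<notin> A ` interior K" by auto
  moreover have "convex (A ` interior K)"
    by (intro convex_linear_image convex_interior K bounded_linear.linear
        blinfun.bounded_linear_right)
  ultimately obtain a where a: "a \<noteq> 0" "\<And>x. x \<in> interior K \<Longrightarrow> 0 \<le> a \<bullet> A x"
    using separating_hyperplane_set_0[of "A ` interior K"] by blast
  have "closed {x. 0 \<le> a \<bullet> A x}"
    by (intro closed_Collect_le continuous_intros)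
  then have "closure (interior K) \<subseteq> {x. 0 \<le> a \<bullet> A x}"
    using a(2) by (intro closure_minimal) auto
  then have aK: "0 \<le> a \<bullet> A x" if "x \<in> K" for x
    using that convex_closure_interior[OF K(2,3)] K(1) by auto
  have ray: "y - t *\<^sub>R a \<in> feasible_y K A c" if t: "0 \<le> t" for t
  proof -
    have "0 \<le> c x - (y - t *\<^sub>R a) \<bullet> A x" if "x \<in> K" for x
      using y that mult_nonneg_nonneg[OF t aK[OF that]]
      by (fastforce simp: feasible_y_def dual_cone_def blinfun.diff_left dual_adjoint_apply
          inner_diff_left)
    then show ?thesis
      by (simp add: feasible_y_def dual_cone_def blinfun.diff_left dual_adjoint_apply)
  qed
  obtain B where B: "\<And>z. z \<in> feasible_y K A c \<Longrightarrow> norm z \<le> B"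
    using bounded by (auto simp: bounded_iff)
  have "0 \<le> B" using B[OF y] norm_ge_zero order_trans by blast
  define t where "t = (B + norm y + 1) / norm a"
  have t: "0 \<le> t" using \<open>0 \<le> B\<close> by (simp add: t_def)
  have "norm (t *\<^sub>R a) = B + norm y + 1"
    using a(1) \<open>0 \<le> B\<close> by (simp add: t_def)
  moreover have "norm (t *\<^sub>R a) \<le> norm y + norm (y - t *\<^sub>R a)"
    using norm_triangle_ineq4[of y "y - t *\<^sub>R a"] by simp
  ultimately show False using B[OF ray[OF t]] by simp
qed

theorem lemma5:
  fixes K :: "'a::euclidean_space set"
    and F :: "'a \<Rightarrow> real" and \<nu> :: real
    and A :: "'a \<Rightarrow>\<^sub>L (real ^ 'm)"
    and b :: "real ^ 'm"
    and c :: "'a \<Rightarrow>\<^sub>L real"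
  assumes "closed_convex_pointed_cone K" and "interior K \<noteq> {}"
    and "normal_barrier K \<nu> F"
    and "b \<noteq> 0"
    and "inj (\<lambda>(y, t). dual_adjoint A y + t *\<^sub>R c)"
    and "\<exists>x y s. x \<in> interior K \<and> s \<in> interior (dual_cone K) \<and>
           A x = b \<and> s + dual_adjoint A y = c"
    and "bounded (feasible_y K A c)"
  shows "nu_g K F A b = ereal \<nu> \<and> ereal \<nu> \<ge> nu_zeta K F A c"
proof -
  interpret log_homogeneous_barrier K F \<nu>
    using assms by unfold_locales auto
  obtain x z where x: "x \<in> interior K" "A x = b"
    and z: "c - dual_adjoint A z \<in> interior (dual_cone K)"
    using assms(6) by (metis add_diff_cancel_right')
  have "z \<in> feasible_y K A c"
    using z interior_subset by (auto simp: feasible_y_def)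
  then obtain d where d: "d \<in> interior K" "A d = 0"
    using kernel_meets_interior[OF closed_K convex_K assms(2,7)] by blast
  have inj: "inj (dual_adjoint A)"
  proof (rule injI)
    fix y y' assume "dual_adjoint A y = dual_adjoint A y'"
    then show "y = y'" using injD[OF assms(5), of "(y, 0)" "(y', 0)"] by simp
  qed
  have "nu_zeta K F A c \<le> ereal \<nu>"
    unfolding nu_zeta_def
  proof (intro SUP_least, unfold ereal_less_eq)
    fix y assume y: "y \<in> interior (feasible_y K A c)"
    have "\<exists>x\<in>interior K. grad F x = - (c - dual_adjoint A y)"
      if "y \<in> interior (feasible_y K A c)" for y
      using interior_feasible_y_coercive[OF that z] gradient_attains[OF assms(2)] by metis
    then show "grad (zeta K F A c) y
      (inv (blinfun_apply (hess (zeta K F A c) y)) (grad (zeta K F A c) y)) \<le> \<nu>"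
      by (rule newton_decrement_zeta_le[OF inj open_interior y])
  qed
  moreover have "nu_g K F A b = ereal \<nu>"
    using nu_g_le nu_g_ge[OF x d] by (rule antisym)
  ultimately show ?thesis by simp
qed

end
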